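(* Let $c\geq 3$ and $k\geq 3$ be integers, and put $\alpha=0$ if $k\equiv 1 \pmod 2$ and $\alpha=\lfloor \frac{c}{4}\rfloor$ if $k\equiv 0\pmod 2$. Then $$\gamma(P(ck,k))\leq \begin{cases} \frac{ck}{2}+\alpha, & \text{if } c\equiv 0 \pmod 4;\\ \frac{ck}{2}+\frac{k}{2}-1+\alpha, & \text{if } c\equiv 1,2 \pmod 4 \text{ and } k\equiv 0 \pmod 2;\\ \frac{ck-1}{2}+\frac{k+1}{2}+\alpha, & \text{if } c\equiv 1 \pmod 4 \text{ and } k\equiv 1 \pmod 2;\\ \frac{ck}{2}+\frac{k+1}{2}+\alpha, & \text{if } c\equiv 2 \pmod 4 \text{ and } k\equiv 1 \pmod 4;\\ \frac{ck}{2}+\frac{k-1}{2}+\alpha, & \text{if } c\equiv 2 \pmod 4 \text{ and } k\equiv 3 \pmod 4;\\ \lfloor\frac{ck}{2}\rfloor+\lfloor\frac{k}{4}\rfloor+1+\alpha, & \text{if } c\equiv 3 \pmod 4 \text{ and } k\neq 4,8;\\ \frac{ck}{2}+\frac{k}{4}+\alpha, & \text{if } c\equiv 3 \pmod 4 \text{ and } k\in\{4,8\}. \end{cases}$$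
   Context: The generalized Petersen graph $P(n,k)$ is the graph on $2n$ vertices with vertex set $\{v_i,u_i: 0\leq i\leq n-1\}$ and edge set $\{v_iv_{i+1},\ v_iu_i,\ u_iu_{i+k}: 0\leq i\leq n-1\}$, subscripts taken modulo $n$. For a graph $G$, a set $S\subseteq V(G)$ is a dominating set if every vertex of $G$ is in $S$ or adjacent to some vertex of $S$; the domination number $\gamma(G)$ is the minimum cardinality of a dominating set of $G$. *)

theory Defs
  imports Complex_Main "Graph_Theory.Pair_Digraph"
begin

text \<open>
  Graphs are the symmetric digraphs of \<^theory>\<open>Graph_Theory.Pair_Digraph\<close>: an undirected edge
  $xy$ is represented by the two arcs $(x,y)$ and $(y,x)$, so that $x$ and $y$ are adjacent iff
  $(x,y)$ is an arc. Finite simple graphs are the instances of the locale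
  \<^locale>\<open>pair_graph\<close>.
\<close>

definition dominating_set :: "'a pair_pre_digraph \<Rightarrow> 'a set \<Rightarrow> bool" where
  "dominating_set G S \<longleftrightarrow>
     S \<subseteq> pverts G \<and> (\<forall>x \<in> pverts G. x \<in> S \<or> (\<exists>y \<in> S. (x, y) \<in> parcs G))"

text \<open>Only meaningful for finite \<open>G\<close>: \<open>card\<close> is \<open>0\<close> on infinite sets.\<close>

definition domination_number :: "'a pair_pre_digraph \<Rightarrow> nat" where
  "domination_number G = Min {card S | S. dominating_set G S}"

datatype petersen_vertex = V nat | U nat

definition petersen_edges :: "nat \<Rightarrow> nat \<Rightarrow> petersen_vertex rel" where
  "petersen_edges n k =
     {(V i, V ((i + 1) mod n)) | i. i < n} \<union>
     {(V i, U i) | i. i < n} \<union>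
     {(U i, U ((i + k) mod n)) | i. i < n}"

definition generalized_petersen :: "nat \<Rightarrow> nat \<Rightarrow> petersen_vertex pair_pre_digraph" where
  "generalized_petersen n k =
     \<lparr>pverts = {V i | i. i < n} \<union> {U i | i. i < n},
      parcs = petersen_edges n k \<union> (petersen_edges n k)\<inverse>\<rparr>"

lemma pair_graph_generalized_petersen:
  assumes "1 < n" "0 < k" "k < n"
  shows "pair_graph (generalized_petersen n k)"
proof -
  let ?G = "generalized_petersen n k"
  have fv: "finite (pverts ?G)"
    by (simp add: generalized_petersen_def)
  have wf: "parcs ?G \<subseteq> pverts ?G \<times> pverts ?G"
    using assms by (auto simp: generalized_petersen_def petersen_edges_def)
  have shift: "(i + j) mod n \<noteq> i" if "i < n" "0 < j" "j < n" for i j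
    using that by (cases "i + j < n") (auto simp: mod_if)
  have shift1: "Suc i mod n \<noteq> i" if "i < n" for i
    using shift[of i 1] that assms by simp
  have noloop: "u \<noteq> v" if "(u, v) \<in> parcs ?G" for u v
    using that shift[of _ k] shift1 assms
    by (auto simp: generalized_petersen_def petersen_edges_def) metis+
  show ?thesis
  proof
    show "finite (parcs ?G)"
      using finite_subset[OF wf] fv by blast
    show "symmetric ?G"
      by (auto simp: symmetric_def sym_def generalized_petersen_def arcs_ends_def arc_to_ends_def
          with_proj_def)
  qed (use fv wf noloop in auto)
qed

lemma card_pverts_generalized_petersen: "card (pverts (generalized_petersen n k)) = 2 * n"
proof -
  have "pverts (generalized_petersen n k) = V ` {..<n} \<union> U ` {..<n}"
    by (auto simp: generalized_petersen_def)
  moreover have "card (V ` {..<n} \<union> U ` {..<n}) = card (V ` {..<n}) + card (U ` {..<n})"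
    by (rule card_Un_disjoint) auto
  ultimately show ?thesis
    by (simp add: card_image inj_on_def)
qed

lemma finite_card_dominating_sets:
  assumes "finite (pverts G)"
  shows "finite {card S | S. dominating_set G S}"
proof -
  have "{card S | S. dominating_set G S} \<subseteq> card ` Pow (pverts G)"
    by (auto simp: dominating_set_def)
  then show ?thesis
    using assms by (meson finite_Pow_iff finite_imageI finite_subset)
qed

lemma domination_number_le:
  assumes "finite (pverts G)" "dominating_set G S"
  shows "domination_number G \<le> card S"
  unfolding domination_number_def
  using assms by (intro Min_le finite_card_dominating_sets) auto

lemma domination_number_attained:
  assumes "finite (pverts G)"
  shows "\<exists>S. dominating_set G S \<and> card S = domination_number G"
proof -
  have "dominating_set G (pverts G)"
    by (simp add: dominating_set_def)
  then have "{card S | S. dominating_set G S} \<noteq> {}"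
    by blast
  from Min_in[OF finite_card_dominating_sets[OF assms] this] show ?thesis
    unfolding domination_number_def by auto
qed

end

theory Submission
  imports Defs
begin

text \<open>
  Write the index \<open>i < c * k\<close> as \<open>r * k + j\<close>, so that the indices fill an array with \<open>c\<close> rows and
  \<open>k\<close> columns and every cell carries one outer vertex \<open>V i\<close> and one inner vertex \<open>U i\<close>. The inner
  neighbours of a cell lie above and below it in its column, cyclically. The outer neighbours lie to
  its left and right in its row; to the right of the last cell of a row comes the first cell of the
  next row.

  Assume first that 4 divides \<open>c\<close>. In the infinite array, mark outer vertices along diagonals in
  which the row changes by one per column and which are four rows apart, and mark inner vertices along
  the diagonals midway between them. Every vertex is then dominated exactly once, at a cost of two
  marked vertices for every four cells. This pattern survives the passage from the end of a row to
  the start of the next one iff the diagonals move, modulo 4, by \<open>-1\<close> over \<open>k\<close> columns: downward diagonals do for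
  \<open>k mod 4 = 3\<close>, upward ones for \<open>k mod 4 = 1\<close>. For even \<open>k\<close> neither does, for parity reasons; but
  the pattern can slip once by one further row at the price of one additional marked vertex in every
  four rows, and this is the summand \<open>\<alpha>\<close>.

  If 4 does not divide \<open>c\<close>, a strip of \<open>c mod 4\<close> further rows absorbs the defect. Its cost does not
  depend on \<open>c\<close>, so the bound has the form \<open>(c div 4) * (2 * k + of_bool (even k))\<close> plus
  \<open>strip_cost (c mod 4) k\<close>; the formulas of the theorem are this sum, case by case.

  Strips and blocks can be chosen to be made of a period of four columns, repeated at will, and a
  tail that depends on \<open>k mod 4\<close> only, apart from \<open>k = 4\<close> and \<open>k = 8\<close>, where a strip of three rows
  can be cheaper by one. Thus finitely many small tables describe dominating sets for
  all \<open>c\<close> and \<open>k\<close>. Domination is a condition on neighbouring cells, so it can be checked on a table,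
  for all its extensions at once, by evaluation
  (\<open>locally_dominating\<close> and \<open>domination_number_le_weight\<close>).
\<close>

section \<open>Words made of a repeated period and a tail\<close>

text \<open>
  In a word that consists of \<open>m\<close> copies of the letters \<open>0, 1, 2, 3\<close> and the tail \<open>4, 5, \<dots>\<close>, this is
  the letter at position \<open>r\<close>. It serves both for the rows and for the columns of the array.
\<close>

definition tile_index :: "nat \<Rightarrow> nat \<Rightarrow> nat" where
  "tile_index m r = (if r < 4 * m then r mod 4 else r - 4 * m + 4)"

text \<open>
  The letters that may precede and follow the letter \<open>y\<close> in such a word over \<open>N\<close> letters, read
  cyclically. There are several candidates because the number of copies is left open: what
  precedes \<open>0\<close> or \<open>4\<close> is the end of the period or the end of the tail.
\<close>

definition before :: "nat \<Rightarrow> nat \<Rightarrow> nat list" where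
  "before N y = (if y \<in> {0, 4} then [3, N - 1] else [y - 1])"

definition after :: "nat \<Rightarrow> nat \<Rightarrow> nat list" where
  "after N y = (if y \<in> {3, N - 1} then [0, 4] else [y + 1])"

lemma tile_index_less: "r < 4 * m + t \<Longrightarrow> tile_index m r < 4 + t"
  using mod_less_divisor[of 4 r] by (auto simp: tile_index_def simp del: mod_less_divisor)

lemma tile_index_first: "tile_index m 0 \<in> {0, 4}"
  by (auto simp: tile_index_def)

lemma tile_index_last: "0 < t \<Longrightarrow> tile_index m (4 * m + t - 1) = 4 + t - 1"
  by (auto simp: tile_index_def)

lemma tile_index_Suc:
  assumes "Suc r < 4 * m + t"
  shows "(tile_index m r = 3 \<and> tile_index m (Suc r) \<in> {0, 4}) \<or>
    (tile_index m r \<notin> {3, 4 + t - 1} \<and> tile_index m (Suc r) \<notin> {0, 4}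
      \<and> tile_index m (Suc r) = tile_index m r + 1)"
proof (cases "r < 4 * m")
  case True
  show ?thesis
  proof (cases "Suc r < 4 * m")
    case True
    have "r mod 4 = 3 \<and> Suc r mod 4 = 0 \<or> r mod 4 < 3 \<and> Suc r mod 4 = r mod 4 + 1"
      by presburger
    then show ?thesis
      using True \<open>r < 4 * m\<close> assms by (auto simp: tile_index_def)
  next
    case False
    with \<open>r < 4 * m\<close> have "Suc r = 4 * m"
      by simp
    then have "r mod 4 = 3"
      by presburger
    then show ?thesis
      using \<open>Suc r = 4 * m\<close> by (simp add: tile_index_def)
  qed
next
  case False
  then show ?thesis
    using assms by (auto simp: tile_index_def)
qed

lemma cyclic_after:
  assumes "r < 4 * m + t" "0 < t"
  shows "tile_index m (Suc r mod (4 * m + t)) \<in> set (after (4 + t) (tile_index m r))"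
proof (cases "Suc r < 4 * m + t")
  case True
  then show ?thesis
    using tile_index_Suc[OF True] by (auto simp: after_def)
next
  case False
  then have "Suc r = 4 * m + t"
    using assms by simp
  then have "r = 4 * m + t - 1" "Suc r mod (4 * m + t) = 0"
    by simp_all
  then show ?thesis
    using tile_index_first[of m] tile_index_last[OF assms(2), of m] by (auto simp: after_def)
qed

lemma cyclic_before:
  assumes "r < 4 * m + t" "0 < t"
  obtains r' where "r' < 4 * m + t" "Suc r' mod (4 * m + t) = r"
    "tile_index m r' \<in> set (before (4 + t) (tile_index m r))"
proof (cases r)
  case 0
  then show ?thesis
    using that[of "4 * m + t - 1"] assms tile_index_first[of m] tile_index_last[OF assms(2), of m]
    by (auto simp: before_def)
next
  case (Suc r')
  then show ?thesis
    using that[of r'] assms tile_index_Suc[of r' m t] by (auto simp: before_def)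
qed

lemma sum_tile_index:
  fixes f :: "nat \<Rightarrow> nat"
  shows "(\<Sum>r<4 * m + t. f (tile_index m r)) = m * (\<Sum>y\<leftarrow>[0..<4]. f y) + (\<Sum>y\<leftarrow>[4..<4 + t]. f y)"
proof (induction t)
  case 0
  have "(\<Sum>r<4 * m. f (r mod 4)) = m * (\<Sum>y\<leftarrow>[0..<4]. f y)"
  proof (induction m)
    case (Suc m)
    have four_more: "4 * Suc m = Suc (Suc (Suc (Suc (4 * m))))"
      by simp
    have residues: "4 * m mod 4 = 0" "Suc (4 * m) mod 4 = 1" "Suc (Suc (4 * m)) mod 4 = 2"
      "Suc (Suc (Suc (4 * m))) mod 4 = 3"
      by presburger+
    have "(\<Sum>r<4 * Suc m. f (r mod 4)) = (\<Sum>r<4 * m. f (r mod 4)) + f 0 + f 1 + f 2 + f 3"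
      by (simp only: four_more sum.lessThan_Suc residues)
    moreover have "[0..<4] = [0, 1, 2, 3]"
      by (simp add: upt_rec)
    ultimately show ?case
      using Suc.IH by simp
  qed simp
  then show ?case
    by (simp add: tile_index_def)
next
  case (Suc t)
  have "[4..<4 + Suc t] = [4..<4 + t] @ [4 + t]"
    by (metis add_Suc_right le_add1 upt_Suc_append)
  then show ?case
    using Suc.IH by (simp add: tile_index_def add.commute[of t 4])
qed

section \<open>Locally dominating tables\<close>

text \<open>
  A table is a list of rows of characters: \<open>u\<close> marks the inner vertex of a cell, \<open>v\<close> the outer one,
  \<open>b\<close> both, and a dot none.
\<close>

definition inner :: "char \<Rightarrow> bool" where
  "inner a \<longleftrightarrow> a = CHR ''u'' \<or> a = CHR ''b''"

definition outer :: "char \<Rightarrow> bool" where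
  "outer a \<longleftrightarrow> a = CHR ''v'' \<or> a = CHR ''b''"

text \<open>
  The cells that may lie to the left and right of the cell \<open>(y, p)\<close> in an extension of a table with
  \<open>N\<close> rows and \<open>M\<close> columns. Columns 0 and 4 may begin a row of the array, and then the left
  neighbour is the end of the preceding row; this passage to another row is the twist of the outer
  cycle.
\<close>

definition left_cells :: "nat \<Rightarrow> nat \<Rightarrow> nat \<Rightarrow> nat \<Rightarrow> (nat \<times> nat) list" where
  "left_cells N M y p =
     (if p \<in> {0, 4} then (y, 3) # map (\<lambda>x. (x, M - 1)) (before N y) else [(y, p - 1)])"

definition right_cells :: "nat \<Rightarrow> nat \<Rightarrow> nat \<Rightarrow> nat \<Rightarrow> (nat \<times> nat) list" where
  "right_cells N M y p =
     (if p = 3 then [(y, 0), (y, 4)]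
      else if p = M - 1 then List.product (after N y) [0, 4]
      else [(y, p + 1)])"

text \<open>
  In an unmarked cell, the inner vertex needs an inner mark above or below, and the outer vertex an
  outer mark to the left or right. The two neighbours in one direction vary independently over the
  candidates, so one of them is marked in every extension iff all candidates on one side are.
\<close>

definition locally_dominating :: "string list \<Rightarrow> nat \<Rightarrow> nat \<Rightarrow> bool" where
  "locally_dominating T N M \<longleftrightarrow>
     (\<forall>y \<in> set [0..<N]. \<forall>p \<in> set [0..<M].
        inner (T ! y ! p) \<or> outer (T ! y ! p) \<or>
        ((\<forall>x \<in> set (before N y). inner (T ! x ! p)) \<or>
         (\<forall>z \<in> set (after N y). inner (T ! z ! p))) \<and>
        ((\<forall>(x, l) \<in> set (left_cells N M y p). outer (T ! x ! l)) \<or>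
         (\<forall>(z, l) \<in> set (right_cells N M y p). outer (T ! z ! l))))"

definition weight :: "string list \<Rightarrow> nat list \<Rightarrow> nat list \<Rightarrow> nat" where
  "weight T ys ps =
     (\<Sum>y\<leftarrow>ys. \<Sum>p\<leftarrow>ps. of_bool (inner (T ! y ! p)) + of_bool (outer (T ! y ! p)))"

lemma index_less:
  fixes c k r j :: nat
  assumes "r < c" "j < k"
  shows "r * k + j < c * k"
proof -
  have "r * k + j < Suc r * k"
    using assms by simp
  also have "\<dots> \<le> c * k"
    using assms by (intro mult_le_mono1) simp
  finally show ?thesis .
qed

text \<open>
  The two edge relations as moves in the array: inner edges lead down a column, outer edges along a
  row and from its end to the beginning of the next row.
\<close>

lemma vertical_step:
  fixes c k r j :: nat
  assumes "r < c" "j < k"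
  shows "(r * k + j + k) mod (c * k) = (Suc r mod c) * k + j"
proof (cases "Suc r < c")
  case True
  then show ?thesis
    using index_less[OF True assms(2)] by (simp add: add_ac)
next
  case False
  then have "c = Suc r"
    using assms by simp
  then have "r * k + j + k = j + c * k" "j < c * k"
    using assms by simp_all
  then show ?thesis
    by (simp only: mod_add_self2 mod_less \<open>c = Suc r\<close> mod_self mult_0 add_0)
qed

lemma horizontal_step:
  fixes c k r j :: nat
  assumes "r < c" "Suc j < k"
  shows "(r * k + j + 1) mod (c * k) = r * k + Suc j"
  using index_less[OF assms] by simp

lemma wrap_step:
  fixes c k r :: nat
  assumes "r < c" "0 < k"
  shows "(r * k + (k - 1) + 1) mod (c * k) = (Suc r mod c) * k + 0"
  using vertical_step[of r c 0 k] assms by simp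

lemma generalized_petersen_adjacency:
  "pverts (generalized_petersen n k) = V ` {..<n} \<union> U ` {..<n}"
  "i < n \<Longrightarrow> (V i, U i) \<in> parcs (generalized_petersen n k)"
  "i < n \<Longrightarrow> (U i, V i) \<in> parcs (generalized_petersen n k)"
  "i < n \<Longrightarrow> (i + 1) mod n = i' \<Longrightarrow> (V i, V i') \<in> parcs (generalized_petersen n k)"
  "i < n \<Longrightarrow> (i + 1) mod n = i' \<Longrightarrow> (V i', V i) \<in> parcs (generalized_petersen n k)"
  "i < n \<Longrightarrow> (i + k) mod n = i' \<Longrightarrow> (U i, U i') \<in> parcs (generalized_petersen n k)"
  "i < n \<Longrightarrow> (i + k) mod n = i' \<Longrightarrow> (U i', U i) \<in> parcs (generalized_petersen n k)"
  by (auto simp: generalized_petersen_def petersen_edges_def)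

text \<open>
  The marks of an extension dominate because every cell of the array has the same neighbourhood as
  some cell of the table with one choice of the candidates. The four weights count the period and the
  tail of the rows separately from those of the columns, so that the total is bilinear in the numbers
  \<open>m\<close> and \<open>q\<close> of repetitions.
\<close>

lemma domination_number_le_weight:
  fixes m q s t :: nat and T :: "string list"
  defines "c \<equiv> 4 * m + t" and "k \<equiv> 4 * q + s"
  assumes "0 < t" "0 < s" and local: "locally_dominating T (4 + t) (4 + s)"
  shows "domination_number (generalized_petersen (c * k) k)
    \<le> m * (q * weight T [0..<4] [0..<4] + weight T [0..<4] [4..<4 + s])
      + (q * weight T [4..<4 + t] [0..<4] + weight T [4..<4 + t] [4..<4 + s])"
proof -
  define cell where "cell r j = T ! tile_index m r ! tile_index q j" for r j
  define cells where "cells P = {(r, j). r < c \<and> j < k \<and> P (cell r j)}" for P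
  define S where "S = (\<lambda>(r, j). V (r * k + j)) ` cells outer \<union> (\<lambda>(r, j). U (r * k + j)) ` cells inner"
  let ?G = "generalized_petersen (c * k) k"
  have pos: "0 < c" "0 < k"
    using assms by (simp_all add: c_def k_def)
  have V_in: "V (r * k + j) \<in> S" if "r < c" "j < k" "outer (cell r j)" for r j
    using that by (auto simp: S_def cells_def image_iff)
  have U_in: "U (r * k + j) \<in> S" if "r < c" "j < k" "inner (cell r j)" for r j
    using that by (auto simp: S_def cells_def image_iff)
  have dominated: "(V (r * k + j) \<in> S \<or> (\<exists>y\<in>S. (V (r * k + j), y) \<in> parcs ?G)) \<and>
      (U (r * k + j) \<in> S \<or> (\<exists>y\<in>S. (U (r * k + j), y) \<in> parcs ?G))"
    if r: "r < c" and j: "j < k" for r j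
  proof -
    let ?i = "r * k + j" and ?N = "4 + t" and ?M = "4 + s"
    let ?y = "tile_index m r" and ?p = "tile_index q j"
    have i: "?i < c * k"
      using index_less[OF r j] .
    obtain r0 where r0: "r0 < c" "Suc r0 mod c = r" "tile_index m r0 \<in> set (before ?N ?y)"
      using cyclic_before[of r m t] r \<open>0 < t\<close> unfolding c_def by metis
    define r1 where "r1 = Suc r mod c"
    have r1: "r1 < c" "tile_index m r1 \<in> set (after ?N ?y)"
      using cyclic_after[of r m t] r \<open>0 < t\<close> pos unfolding c_def r1_def by auto
    have "?y \<in> set [0..<?N]" "?p \<in> set [0..<?M]"
      using tile_index_less[of r m t] tile_index_less[of j q s] r j by (simp_all add: c_def k_def)
    then consider "inner (cell r j)" | "outer (cell r j)"
      | "(\<forall>x \<in> set (before ?N ?y). inner (T ! x ! ?p)) \<or> (\<forall>z \<in> set (after ?N ?y). inner (T ! z ! ?p))"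
        "(\<forall>(x, l) \<in> set (left_cells ?N ?M ?y ?p). outer (T ! x ! l)) \<or>
         (\<forall>(z, l) \<in> set (right_cells ?N ?M ?y ?p). outer (T ! z ! l))"
      using local unfolding locally_dominating_def cell_def by blast
    then show ?thesis
    proof cases
      case 1
      then show ?thesis
        using U_in[OF r j] generalized_petersen_adjacency(2)[OF i, of k] by blast
    next
      case 2
      then show ?thesis
        using V_in[OF r j] generalized_petersen_adjacency(3)[OF i, of k] by blast
    next
      case 3
      \<comment> \<open>The cells to the left and right may lie in an adjacent row.\<close>
      obtain ra ja where left: "ra < c" "ja < k" "(ra * k + ja + 1) mod (c * k) = ?i"
        "(tile_index m ra, tile_index q ja) \<in> set (left_cells ?N ?M ?y ?p)"
      proof (cases j)
        case 0
        show ?thesis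
        proof (rule that[of r0 "k - 1"])
          show "(r0 * k + (k - 1) + 1) mod (c * k) = ?i"
            using wrap_step[OF r0(1) pos(2)] r0(2) 0 by simp
          show "(tile_index m r0, tile_index q (k - 1)) \<in> set (left_cells ?N ?M ?y ?p)"
            using r0(3) tile_index_first[of q] tile_index_last[OF \<open>0 < s\<close>, of q] 0
            unfolding left_cells_def k_def by auto
        qed (use r0 pos in auto)
      next
        case (Suc ja)
        show ?thesis
        proof (rule that[of r ja])
          show "(tile_index m r, tile_index q ja) \<in> set (left_cells ?N ?M ?y ?p)"
            using tile_index_Suc[of ja q s] j Suc unfolding left_cells_def k_def by auto
        qed (use horizontal_step[OF r] j r Suc in auto)
      qed
      obtain rb jb where right: "rb < c" "jb < k" "(?i + 1) mod (c * k) = rb * k + jb"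
        "(tile_index m rb, tile_index q jb) \<in> set (right_cells ?N ?M ?y ?p)"
      proof (cases "Suc j < k")
        case False
        then have last: "j = k - 1"
          using j by simp
        show ?thesis
        proof (rule that[of r1 0])
          show "(?i + 1) mod (c * k) = r1 * k + 0"
            using wrap_step[OF r pos(2)] by (simp only: last r1_def)
          show "(tile_index m r1, tile_index q 0) \<in> set (right_cells ?N ?M ?y ?p)"
            using r1(2) tile_index_first[of q] tile_index_last[OF \<open>0 < s\<close>, of q] last \<open>0 < s\<close>
            unfolding right_cells_def k_def by auto
        qed (use r1 pos in auto)
      next
        case True
        show ?thesis
        proof (rule that[of r "Suc j"])
          show "(tile_index m r, tile_index q (Suc j)) \<in> set (right_cells ?N ?M ?y ?p)"
            using tile_index_Suc[of j q s] True unfolding right_cells_def k_def by auto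
        qed (use horizontal_step[OF r True] True r in auto)
      qed
      have "outer (cell ra ja) \<or> outer (cell rb jb)"
        using 3(2) left(4) right(4) unfolding cell_def by blast
      then have "\<exists>y\<in>S. (V ?i, y) \<in> parcs ?G"
        using V_in[OF left(1,2)] V_in[OF right(1,2)] index_less[OF left(1,2)] left(3) right(3) i
          generalized_petersen_adjacency(4,5) by metis
      moreover have "inner (cell r0 j) \<or> inner (cell r1 j)"
        using 3(1) r0(3) r1(2) unfolding cell_def by blast
      then have "\<exists>y\<in>S. (U ?i, y) \<in> parcs ?G"
        using U_in[OF r0(1) j] U_in[OF r1(1) j] index_less[OF r0(1) j] i
          vertical_step[OF r0(1) j] vertical_step[OF r j] r0(2) r1_def
          generalized_petersen_adjacency(6,7) by metis
      ultimately show ?thesis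
        by blast
    qed
  qed
  have "dominating_set ?G S"
    unfolding dominating_set_def
  proof
    show "S \<subseteq> pverts ?G"
      by (auto simp: S_def cells_def generalized_petersen_adjacency(1) index_less)
    show "\<forall>x\<in>pverts ?G. x \<in> S \<or> (\<exists>y\<in>S. (x, y) \<in> parcs ?G)"
    proof
      fix x
      assume "x \<in> pverts ?G"
      then obtain i where i: "i < c * k" "x = V i \<or> x = U i"
        by (auto simp: generalized_petersen_adjacency(1))
      have "i div k < c" "i mod k < k" "i = (i div k) * k + i mod k"
        using i pos by (simp_all add: less_mult_imp_div_less)
      then show "x \<in> S \<or> (\<exists>y\<in>S. (x, y) \<in> parcs ?G)"
        using dominated i(2) by metis
    qed
  qed
  moreover have "finite (pverts ?G)"
    by (simp add: generalized_petersen_adjacency(1))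
  ultimately have "domination_number ?G \<le> card S"
    by (rule domination_number_le[rotated])
  also have "card S \<le> card (cells outer) + card (cells inner)"
  proof -
    have "finite (cells P)" for P
      by (rule finite_subset[of _ "{..<c} \<times> {..<k}"]) (auto simp: cells_def)
    then show ?thesis
      unfolding S_def by (meson add_mono card_Un_le card_image_le le_trans)
  qed
  also have "card (cells P) = (\<Sum>r<c. \<Sum>j<k. of_bool (P (cell r j)))" for P
  proof -
    have "cells P = {x \<in> {..<c} \<times> {..<k}. P (cell (fst x) (snd x))}"
      by (auto simp: cells_def)
    then have "card (cells P) = (\<Sum>x\<in>{..<c} \<times> {..<k}. of_bool (P (cell (fst x) (snd x))))"
      by (simp add: Int_def)
    also have "\<dots> = (\<Sum>r<c. \<Sum>j<k. of_bool (P (cell r j)))"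
      by (simp only: sum.cartesian_product split_def)
    finally show ?thesis .
  qed
  then have "card (cells outer) + card (cells inner)
      = (\<Sum>r<c. \<Sum>j<k. of_bool (inner (cell r j)) + of_bool (outer (cell r j)))"
    by (simp add: sum.distrib)
  also have "\<dots> = m * (q * weight T [0..<4] [0..<4] + weight T [0..<4] [4..<4 + s])
      + (q * weight T [4..<4 + t] [0..<4] + weight T [4..<4 + t] [4..<4 + s])"
  proof -
    define w :: "nat \<Rightarrow> nat \<Rightarrow> nat"
      where "w y p = of_bool (inner (T ! y ! p)) + of_bool (outer (T ! y ! p))" for y p
    have "(\<Sum>r<c. \<Sum>j<k. w (tile_index m r) (tile_index q j))
        = (\<Sum>r<c. q * (\<Sum>p\<leftarrow>[0..<4]. w (tile_index m r) p) + (\<Sum>p\<leftarrow>[4..<4 + s]. w (tile_index m r) p))"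
      unfolding k_def by (intro sum.cong refl sum_tile_index)
    also have "\<dots> = m * (\<Sum>y\<leftarrow>[0..<4]. q * (\<Sum>p\<leftarrow>[0..<4]. w y p) + (\<Sum>p\<leftarrow>[4..<4 + s]. w y p))
        + (\<Sum>y\<leftarrow>[4..<4 + t]. q * (\<Sum>p\<leftarrow>[0..<4]. w y p) + (\<Sum>p\<leftarrow>[4..<4 + s]. w y p))"
      unfolding c_def by (rule sum_tile_index)
    finally show ?thesis
      unfolding cell_def weight_def w_def[symmetric] by (simp only: sum_list_addf sum_list_const_mult)
  qed
  finally show ?thesis .
qed

section \<open>The tables\<close>

definition certified :: "string list \<Rightarrow> nat \<Rightarrow> nat \<Rightarrow> nat \<Rightarrow> nat \<Rightarrow> nat \<Rightarrow> nat \<Rightarrow> bool" where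
  "certified T t s a b d e \<longleftrightarrow>
     0 < t \<and> 0 < s \<and> locally_dominating T (4 + t) (4 + s) \<and>
     weight T [0..<4] [0..<4] = a \<and> weight T [0..<4] [4..<4 + s] = b \<and>
     weight T [4..<4 + t] [0..<4] = d \<and> weight T [4..<4 + t] [4..<4 + s] = e"

lemma domination_number_le_certified:
  assumes "certified T t s a b d e"
  shows "domination_number (generalized_petersen ((4 * m + t) * (4 * q + s)) (4 * q + s))
    \<le> m * (q * a + b) + (q * d + e)"
  using domination_number_le_weight[of t s T m q] assms by (auto simp: certified_def)

text \<open>
  The suffix of a name is the number \<open>s\<close> of tail columns, which range over \<open>3, 4, 5, 6\<close> to cover all
  \<open>k \<ge> 3\<close>. The numbers of tail rows range over \<open>3, 4, 5, 6\<close> as well: a strip of one or two rows is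
  tabulated below another copy of the block, and the block itself is the tail when \<open>c\<close> is a
  multiple of 4.

  In \<open>block_3\<close> and \<open>block_6\<close> the diagonals run downward, in \<open>block_4\<close> and \<open>block_5\<close> upward;
  \<open>block_4\<close> and \<open>block_6\<close> slip in the tail, which therefore costs \<open>2 * s + 1\<close> instead of \<open>2 * s\<close>.
  The slip makes a downward pattern move by \<open>k + 1\<close> rows and an upward one by \<open>- (k + 1)\<close>, which is
  \<open>-1\<close> modulo 4 for \<open>k mod 4 = 2\<close> and \<open>k mod 4 = 0\<close> respectively.
\<close>

definition block_3 :: "string list" where
  "block_3 =
    [''v.u.v.u'',
     ''.v.u.v.'',
     ''u.v.u.v'',
     ''.u.v.u.'']"

definition one_3 :: "string list" where
  "one_3 =
    [''vuuuvuu'']"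

definition two_3 :: "string list" where
  "two_3 =
    [''v.u.v.u'',
     ''vuvuvu.'']"

definition three_3 :: "string list" where
  "three_3 =
    [''v.u.v.u'',
     ''.v.uu.v'',
     ''uu.v.u.'']"

lemma certified_three_3: "certified (block_3 @ three_3) 3 3 8 6 7 5"
  unfolding block_3_def three_3_def by code_simp

lemma certified_four_3: "certified (block_3 @ block_3) 4 3 8 6 8 6"
  unfolding block_3_def by code_simp

lemma certified_five_3: "certified (block_3 @ block_3 @ one_3) 5 3 8 6 12 9"
  unfolding block_3_def one_3_def by code_simp

lemma certified_six_3: "certified (block_3 @ block_3 @ two_3) 6 3 8 6 14 10"
  unfolding block_3_def two_3_def by code_simp

definition block_4 :: "string list" where
  "block_4 =
    [''v.u.vu.v'',
     ''.u.v..v.'',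
     ''u.v.uv.u'',
     ''.v.u.vu.'']"

definition one_4 :: "string list" where
  "one_4 =
    [''vuuuv.uv'']"

definition two_4 :: "string list" where
  "two_4 =
    [''v.u.vv.u'',
     ''uuvuv.u.'']"

definition three_4 :: "string list" where
  "three_4 =
    [''vuu.vu.v'',
     ''u.v..v.u'',
     ''.v.uuuu.'']"

lemma certified_three_4: "certified (block_4 @ three_4) 3 4 8 9 7 8"
  unfolding block_4_def three_4_def by code_simp

lemma certified_four_4: "certified (block_4 @ block_4) 4 4 8 9 8 9"
  unfolding block_4_def by code_simp

lemma certified_five_4: "certified (block_4 @ block_4 @ one_4) 5 4 8 9 12 12"
  unfolding block_4_def one_4_def by code_simp

lemma certified_six_4: "certified (block_4 @ block_4 @ two_4) 6 4 8 9 14 14"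
  unfolding block_4_def two_4_def by code_simp

definition block_5 :: "string list" where
  "block_5 =
    [''v.u.v.u.v'',
     ''.u.v.u.v.'',
     ''u.v.u.v.u'',
     ''.v.u.v.u.'']"

definition one_5 :: "string list" where
  "one_5 =
    [''vvuuvuuuv'']"

definition two_5 :: "string list" where
  "two_5 =
    [''v.u.v.u.v'',
     ''uuvuuuuuv'']"

definition three_5 :: "string list" where
  "three_5 =
    [''v.u.vuu.v'',
     ''.u.v..v.u'',
     ''u.vuuv.u.'']"

lemma certified_three_5: "certified (block_5 @ three_5) 3 5 8 10 7 9"
  unfolding block_5_def three_5_def by code_simp

lemma certified_four_5: "certified (block_5 @ block_5) 4 5 8 10 8 10"
  unfolding block_5_def by code_simp

lemma certified_five_5: "certified (block_5 @ block_5 @ one_5) 5 5 8 10 12 15"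
  unfolding block_5_def one_5_def by code_simp

lemma certified_six_5: "certified (block_5 @ block_5 @ two_5) 6 5 8 10 14 18"
  unfolding block_5_def two_5_def by code_simp

definition block_6 :: "string list" where
  "block_6 =
    [''v.u.v.u.vu'',
     ''.v.u.v.uv.'',
     ''u.v.u.v..v'',
     ''.u.v.u.vu.'']"

definition one_6 :: "string list" where
  "one_6 =
    [''vuuuvuuv.u'']"

definition two_6 :: "string list" where
  "two_6 =
    [''v.uuv.uuuu'',
     ''uuv.vu.v..'']"

definition three_6 :: "string list" where
  "three_6 =
    [''v.u.v.u.vu'',
     ''uv.u.v.u.v'',
     ''.u.vuu.vu.'']"

lemma certified_three_6: "certified (block_6 @ three_6) 3 6 8 13 7 11"
  unfolding block_6_def three_6_def by code_simp

lemma certified_four_6: "certified (block_6 @ block_6) 4 6 8 13 8 13"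
  unfolding block_6_def by code_simp

lemma certified_five_6: "certified (block_6 @ block_6 @ one_6) 5 6 8 13 12 18"
  unfolding block_6_def one_6_def by code_simp

lemma certified_six_6: "certified (block_6 @ block_6 @ two_6) 6 6 8 13 14 21"
  unfolding block_6_def two_6_def by code_simp

text \<open>
  For \<open>k = 4\<close> and \<open>k = 8\<close> there are strips of three rows that are cheaper by one than those
  above. These two tables are used without repeating the columns. The first four columns of
  \<open>four_columns\<close> never occur; they are marked throughout, so that no condition fails on them.
\<close>

definition four_columns :: "string list" where
  "four_columns =
    [''bbbb.b.u'',
     ''bbbbu.v.'',
     ''bbbb.v..'',
     ''bbbbv.uu'',
     ''bbbbuu.v'',
     ''bbbb..v.'',
     ''bbbbv.uu'']"

lemma certified_four_columns: "certified four_columns 3 4 32 9 24 7"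
  unfolding four_columns_def by code_simp

definition eight_columns :: "string list" where
  "eight_columns =
    [''v.u.v.u.v.uv'',
     ''.u.v.u.v.u.v'',
     ''u.v.u.v.u.v.'',
     ''.v.u.v.u.v.u'',
     ''v.uv.vu.v.uv'',
     ''.u.vuv..vu.v'',
     ''uv.u.v.uv..v'']"

lemma certified_eight_columns: "certified eight_columns 3 8 8 17 8 14"
  unfolding eight_columns_def by code_simp

section \<open>The bound\<close>

definition strip_cost :: "nat \<Rightarrow> nat \<Rightarrow> nat" where
  "strip_cost t k =
     (if t = 1 then if even k then k - 1 else k
      else if t = 2 then
        if even k then k + k div 2 - 1 else if k mod 4 = 1 then k + (k + 1) div 2 else k + (k - 1) div 2
      else if t = 3 then
        if k = 4 \<or> k = 8 then k + k div 2 + k div 4 else k + k div 2 + k div 4 + 1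
      else 0)"

lemma quotient_offset_3:
  fixes n :: nat
  assumes "3 \<le> n"
  obtains m t where "n = 4 * m + t" "t \<in> {3, 4, 5, 6}"
proof
  show "n = 4 * ((n - 3) div 4) + (3 + (n - 3) mod 4)"
    using assms by presburger
  have "(n - 3) mod 4 < 4"
    by simp
  then show "3 + (n - 3) mod 4 \<in> {3, 4, 5, 6}"
    by auto
qed

text \<open>
  Writing \<open>c = 4 * m + t\<close> and \<open>k = 4 * q + s\<close> with \<open>t\<close> and \<open>s\<close> in \<open>{3, 4, 5, 6}\<close> selects the table.
\<close>

lemma domination_number_le_strip_cost:
  fixes c k :: nat
  assumes "3 \<le> c" "3 \<le> k"
  shows "domination_number (generalized_petersen (c * k) k)
    \<le> (c div 4) * (2 * k + of_bool (even k)) + strip_cost (c mod 4) k"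
proof -
  obtain m t where c: "c = 4 * m + t" "t \<in> {3, 4, 5, 6}"
    using quotient_offset_3[OF assms(1)] .
  obtain q s where k: "k = 4 * q + s" "s \<in> {3, 4, 5, 6}"
    using quotient_offset_3[OF assms(2)] .
  show ?thesis
  proof (cases "t = 3 \<and> k \<in> {4, 8}")
    case True
    then show ?thesis
      using domination_number_le_certified[OF certified_four_columns, of m 0]
        domination_number_le_certified[OF certified_eight_columns, of m 0]
      by (auto simp: c strip_cost_def)
  next
    case False
    define D where "D = domination_number (generalized_petersen (c * k) k)"
    \<comment> \<open>As implications, the bounds of all tables can be supplied at once; each case keeps its own.\<close>
    have certificate: "t = t' \<longrightarrow> s = s' \<longrightarrow> D \<le> m * (q * a + b) + (q * d + e)"
      if "certified T t' s' a b d e" for T t' s' a b d e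
      using domination_number_le_certified[OF that, of m q] c k by (auto simp: D_def)
    have c_facts: "c div 4 = (if t = 3 then m else m + 1)" "c mod 4 = (if t = 3 then 3 else t - 4)"
      using c(2) unfolding c(1) by auto
    have k_facts: "even k \<longleftrightarrow> even s" "k mod 4 = s mod 4" "k div 2 = 2 * q + s div 2"
        "(k + 1) div 2 = 2 * q + (s + 1) div 2" "(k - 1) div 2 = 2 * q + (s - 1) div 2"
        "k div 4 = q + s div 4"
      using k(2) unfolding k(1) by auto
    have "D \<le> (c div 4) * (2 * k + of_bool (even k)) + strip_cost (c mod 4) k"
      using c(2) k(2) False
        certified_three_3[THEN certificate] certified_four_3[THEN certificate]
        certified_five_3[THEN certificate] certified_six_3[THEN certificate]
        certified_three_4[THEN certificate] certified_four_4[THEN certificate]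
        certified_five_4[THEN certificate] certified_six_4[THEN certificate]
        certified_three_5[THEN certificate] certified_four_5[THEN certificate]
        certified_five_5[THEN certificate] certified_six_5[THEN certificate]
        certified_three_6[THEN certificate] certified_four_6[THEN certificate]
        certified_five_6[THEN certificate] certified_six_6[THEN certificate]
      unfolding strip_cost_def c_facts k_facts k(1)
      by (elim insertE emptyE) (simp_all add: algebra_simps)
    then show ?thesis
      by (simp only: D_def)
  qed
qed

theorem theorem2p1:
  fixes c k :: nat and \<alpha> :: int
  assumes "c \<ge> 3" and "k \<ge> 3"
    and "\<alpha> = (if k mod 2 = 1 then 0 else \<lfloor>real c / 4\<rfloor>)"
  defines "\<gamma> \<equiv> real (domination_number (generalized_petersen (c * k) k))"
  shows
    "(c mod 4 = 0 \<longrightarrow>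
        \<gamma> \<le> real (c * k) / 2 + \<alpha>) \<and>
     (c mod 4 \<in> {1, 2} \<and> k mod 2 = 0 \<longrightarrow>
        \<gamma> \<le> real (c * k) / 2 + real k / 2 - 1 + \<alpha>) \<and>
     (c mod 4 = 1 \<and> k mod 2 = 1 \<longrightarrow>
        \<gamma> \<le> (real (c * k) - 1) / 2 + (real k + 1) / 2 + \<alpha>) \<and>
     (c mod 4 = 2 \<and> k mod 4 = 1 \<longrightarrow>
        \<gamma> \<le> real (c * k) / 2 + (real k + 1) / 2 + \<alpha>) \<and>
     (c mod 4 = 2 \<and> k mod 4 = 3 \<longrightarrow>
        \<gamma> \<le> real (c * k) / 2 + (real k - 1) / 2 + \<alpha>) \<and>
     (c mod 4 = 3 \<and> k \<notin> {4, 8} \<longrightarrow>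
        \<gamma> \<le> \<lfloor>real (c * k) / 2\<rfloor> + \<lfloor>real k / 4\<rfloor> + 1 + \<alpha>) \<and>
     (c mod 4 = 3 \<and> k \<in> {4, 8} \<longrightarrow>
        \<gamma> \<le> real (c * k) / 2 + real k / 4 + \<alpha>)"
proof -
  define B where "B = (c div 4) * (2 * k + of_bool (even k)) + strip_cost (c mod 4) k"
  have "domination_number (generalized_petersen (c * k) k) \<le> B"
    unfolding B_def by (rule domination_number_le_strip_cost[OF assms(1,2)])
  then have le: "\<gamma> \<le> real B"
    by (simp add: \<gamma>_def)
  have floors: "\<lfloor>real n / 2\<rfloor> = int (n div 2)" "\<lfloor>real n / 4\<rfloor> = int (n div 4)" for n :: nat
    using floor_divide_of_nat_eq[of n 2, where ?'a = real] floor_divide_of_nat_eq[of n 4, where ?'a = real]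
    by simp_all
  define m where "m = c div 4"
  have \<alpha>: "\<alpha> = of_bool (even k) * int m"
    unfolding assms(3) floors m_def by (cases "even k") (auto simp: odd_iff_mod_2_eq_one even_iff_mod_2_eq_zero)
  have c: "c = 4 * m + c mod 4"
    by (simp add: m_def)
  have B: "B = m * (2 * k + of_bool (even k)) + strip_cost (c mod 4) k"
    by (simp add: B_def m_def)
  show ?thesis
  proof (intro conjI impI)
    assume "c mod 4 = 0"
    then show "\<gamma> \<le> real (c * k) / 2 + \<alpha>"
      using le c by (cases "even k") (simp_all add: B \<alpha> strip_cost_def algebra_simps)
  next
    assume "c mod 4 \<in> {1, 2} \<and> k mod 2 = 0"
    then obtain h where h: "k = 2 * h" and t: "c mod 4 = 1 \<or> c mod 4 = 2"
      by auto
    then show "\<gamma> \<le> real (c * k) / 2 + real k / 2 - 1 + \<alpha>"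
      using le c t assms(2) by (auto simp: B \<alpha> strip_cost_def algebra_simps of_nat_diff)
  next
    assume t: "c mod 4 = 1 \<and> k mod 2 = 1"
    then have "odd k"
      by presburger
    then show "\<gamma> \<le> (real (c * k) - 1) / 2 + (real k + 1) / 2 + \<alpha>"
      using le c t by (simp add: B \<alpha> strip_cost_def) (simp add: field_simps)
  next
    assume t: "c mod 4 = 2 \<and> k mod 4 = 1"
    define h where "h = k div 4"
    have "k = 4 * h + 1"
      using t unfolding h_def by presburger
    then show "\<gamma> \<le> real (c * k) / 2 + (real k + 1) / 2 + \<alpha>"
      using le c t by (simp add: B \<alpha> strip_cost_def) (simp add: field_simps)
  next
    assume t: "c mod 4 = 2 \<and> k mod 4 = 3"
    define h where "h = k div 4"
    have "k = 4 * h + 3"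
      using t unfolding h_def by presburger
    then show "\<gamma> \<le> real (c * k) / 2 + (real k - 1) / 2 + \<alpha>"
      using le c t by (simp add: B \<alpha> strip_cost_def) (simp add: field_simps)
  next
    assume t: "c mod 4 = 3 \<and> k \<notin> {4, 8}"
    then have "c * k = k + 2 * (2 * (m * k) + k)"
      using c by (simp add: algebra_simps)
    then have "(c * k) div 2 = 2 * (m * k) + k + k div 2"
      by simp
    then show "\<gamma> \<le> \<lfloor>real (c * k) / 2\<rfloor> + \<lfloor>real k / 4\<rfloor> + 1 + \<alpha>"
      using le t unfolding floors by (simp add: B \<alpha> strip_cost_def algebra_simps)
  next
    assume "c mod 4 = 3 \<and> k \<in> {4, 8}"
    then show "\<gamma> \<le> real (c * k) / 2 + real k / 4 + \<alpha>"
      using le c by (auto simp: B \<alpha> strip_cost_def field_simps)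
  qed
qed

end
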